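(* Let $G$ be a simple mixed graph on $n$ vertices and let $u,v\in V_G$. (i) If there is no edge joining $u$ and $v$ in $G$, then $\boldsymbol{\nu}_{2n-1}(G)\leq\frac{1}{2}(d(u)+d(v)+d^+(u)+d^+(v))$ and $\boldsymbol{\nu}_{2n-1}(G)\leq\frac{1}{2}(d(u)+d(v)+d^-(u)+d^-(v))$. (ii) If there is no arc from $u$ to $v$ in $G$, then $\boldsymbol{\nu}_{2n-1}(G)\leq\frac{1}{2}(d(u)+d(v)+d^+(u)+d^-(v))$. Here $\boldsymbol{\nu}_{2n-1}(G)$ is the second smallest eigenvalue of the integrated Laplacian matrix of $G$.
   Context: A mixed graph $G$ has a finite vertex set $V_G$, a multiset $E_G$ of edges (unordered pairs) and a multiset $\vec{E}_G$ of arcs (ordered pairs); it is simple if it has no loops, directed loops, multiple edges or multiple arcs. $d(v)$ is the number of edges at $v$; $d^+(v)$ (resp. $d^-(v)$) is the number of arcs starting (resp. ending) at $v$. For $V_G=\{v_1,\dots,v_n\}$, the integrated adjacency matrix $\mathcal{I}(G)$ is the $2n\times 2n$ matrix indexed by $v'_1,\dots,v'_n,v''_1,\dots,v''_n$ whose $(v'_i,v'_j)$ and $(v''_i,v''_j)$ entries are the number of edges joining $v_i,v_j$ and whose $(v'_i,v''_j)$ and $(v''_j,v'_i)$ entries are the number of arcs from $v_i$ to $v_j$. The integrated degree matrix $\mathcal{I}^D(G)$ is diagonal with $(v'_i,v'_i)$ entry $d(v_i)+d^+(v_i)$ and $(v''_i,v''_i)$ entry $d(v_i)+d^-(v_i)$;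 the integrated Laplacian matrix is $\mathcal{I}^L(G)=\mathcal{I}^D(G)-\mathcal{I}(G)$, with eigenvalues $\boldsymbol{\nu}_1(G)\ge\cdots\ge\boldsymbol{\nu}_{2n}(G)$. *)

theory Defs
  imports
    "Jordan_Normal_Form.Char_Poly"
    "HOL-Library.Uprod"
begin

record 'a mixed_graph =
  verts :: "'a set"
  edges :: "'a uprod multiset"
  arcs :: "('a \<times> 'a) multiset"

definition is_mixed_graph :: "'a mixed_graph \<Rightarrow> bool" where
  "is_mixed_graph G \<longleftrightarrow>
     finite (verts G) \<and>
     (\<forall>e \<in># edges G. set_uprod e \<subseteq> verts G) \<and>
     (\<forall>a \<in># arcs G. fst a \<in> verts G \<and> snd a \<in> verts G)"

text \<open>An edge between two vertices may coexist with arcs between them, and both arcs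
  \<open>(x, y)\<close> and \<open>(y, x)\<close> may be present.\<close>

definition simple_mixed_graph :: "'a mixed_graph \<Rightarrow> bool" where
  "simple_mixed_graph G \<longleftrightarrow>
     is_mixed_graph G \<and>
     (\<forall>x. Upair x x \<notin># edges G) \<and>
     (\<forall>x. (x, x) \<notin># arcs G) \<and>
     (\<forall>e. count (edges G) e \<le> 1) \<and>
     (\<forall>a. count (arcs G) a \<le> 1)"

definition deg :: "'a mixed_graph \<Rightarrow> 'a \<Rightarrow> nat" where
  "deg G x = size {#e \<in># edges G. x \<in> set_uprod e#}"

definition out_deg :: "'a mixed_graph \<Rightarrow> 'a \<Rightarrow> nat" where
  "out_deg G x = size {#a \<in># arcs G. fst a = x#}"

definition in_deg :: "'a mixed_graph \<Rightarrow> 'a \<Rightarrow> nat" where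
  "in_deg G x = size {#a \<in># arcs G. snd a = x#}"

text \<open>The matrices depend on an enumeration of the vertices, given by a list \<open>vs\<close> without
  repetitions whose set is \<open>verts G\<close>. With \<open>n = length vs\<close>, index \<open>i < n\<close> stands for the
  primed copy of \<open>vs ! i\<close> and index \<open>n + i\<close> for its double-primed copy.\<close>

definition edge_mat :: "'a mixed_graph \<Rightarrow> 'a list \<Rightarrow> real mat" where
  "edge_mat G vs = mat (length vs) (length vs)
     (\<lambda>(i, j). real (count (edges G) (Upair (vs ! i) (vs ! j))))"

definition arc_mat :: "'a mixed_graph \<Rightarrow> 'a list \<Rightarrow> real mat" where
  "arc_mat G vs = mat (length vs) (length vs)
     (\<lambda>(i, j). real (count (arcs G) (vs ! i, vs ! j)))"

definition integrated_adjacency :: "'a mixed_graph \<Rightarrow> 'a list \<Rightarrow> real mat" where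
  "integrated_adjacency G vs =
     four_block_mat (edge_mat G vs) (arc_mat G vs)
                    (transpose_mat (arc_mat G vs)) (edge_mat G vs)"

definition integrated_degree :: "'a mixed_graph \<Rightarrow> 'a list \<Rightarrow> real mat" where
  "integrated_degree G vs = (let n = length vs in
     four_block_mat (mat_diag n (\<lambda>i. real (deg G (vs ! i) + out_deg G (vs ! i)))) (0\<^sub>m n n)
                    (0\<^sub>m n n) (mat_diag n (\<lambda>i. real (deg G (vs ! i) + in_deg G (vs ! i)))))"

definition integrated_laplacian :: "'a mixed_graph \<Rightarrow> 'a list \<Rightarrow> real mat" where
  "integrated_laplacian G vs = integrated_degree G vs - integrated_adjacency G vs"

text \<open>Real eigenvalues with algebraic multiplicity, in non-increasing order. A symmetric
  \<open>m \<times> m\<close> real matrix has exactly \<open>m\<close> of them.\<close>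

definition eigenvalues_desc :: "real mat \<Rightarrow> real list" where
  "eigenvalues_desc A = rev (sorted_list_of_multiset (proots (char_poly A)))"

text \<open>The subscript \<open>k\<close> is counted from \<open>1\<close>, so that \<open>nu G vs 1\<close> is the largest eigenvalue and
  \<open>nu G vs (2 * n)\<close> the smallest.\<close>

definition nu :: "'a mixed_graph \<Rightarrow> 'a list \<Rightarrow> nat \<Rightarrow> real" where
  "nu G vs k = eigenvalues_desc (integrated_laplacian G vs) ! (k - 1)"

end

(* By Courant-Fischer, if the quadratic form of a real symmetric matrix is at most r times the
   squared norm on some plane, then its second smallest eigenvalue is at most r. The integrated
   Laplacian has zero row sums, so the plane may be spanned by the all-ones vector and any nonzero
   vector x orthogonal to it, with only x entering the quadratic form. For two distinct copies
   of vertices whose entry vanishes, x is the difference of their unit vectors. If u = v in part (i),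
   this x is zero; then u' and u'' are distinct and non-adjacent, and Fiedler's test vector for
   the vertex u' (respectively u'') shows that the eigenvalue is at most the corresponding
   diagonal entry. *)

theory Submission
  imports Defs
begin

section \<open>Spectral theorem for real symmetric matrices\<close>

lemma symmetric_mat_self_adjoint:
  fixes A :: "'a :: comm_semiring_0 mat"
  assumes A: "A \<in> carrier_mat n n" "transpose_mat A = A"
    and x: "x \<in> carrier_vec n" and y: "y \<in> carrier_vec n"
  shows "(A *\<^sub>v x) \<bullet> y = x \<bullet> (A *\<^sub>v y)"
  using transpose_vec_mult_scalar[OF A(1) y x] A(2) by simp

lemma scalar_prod_self_nonneg: "(x :: real vec) \<bullet> x \<ge> 0"
  by (auto simp: scalar_prod_def intro!: sum_nonneg)

lemma scalar_prod_self_eq_0_iff: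
  assumes "(x :: real vec) \<in> carrier_vec n"
  shows "x \<bullet> x = 0 \<longleftrightarrow> x = 0\<^sub>v n"
proof
  assume "x \<bullet> x = 0"
  then have "\<forall>i\<in>{0..<n}. x $ i * x $ i = 0"
    using assms by (subst sum_nonneg_eq_0_iff[symmetric]) (auto simp: scalar_prod_def)
  then show "x = 0\<^sub>v n" using assms by auto
qed (use assms in auto)

lemma scalar_prod_self_pos:
  assumes "(x :: real vec) \<in> carrier_vec n" "x \<noteq> 0\<^sub>v n"
  shows "x \<bullet> x > 0"
  using scalar_prod_self_nonneg[of x] scalar_prod_self_eq_0_iff[OF assms(1)] assms(2)
  by linarith

text \<open>Write an eigenvector for \<open>c\<close> as x + iy with x and y real. Comparing the two
  sides of self-adjointness for x and y leaves \<open>Im c\<close> times the sum of their squared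
  norms equal to 0, and that sum is positive.\<close>

lemma symmetric_real_mat_eigenvalue_real:
  assumes A: "A \<in> carrier_mat n n" "transpose_mat A = A"
    and ev: "eigenvalue (map_mat complex_of_real A) c"
  shows "Im c = 0"
proof -
  from ev A obtain v where v: "v \<in> carrier_vec n" "v \<noteq> 0\<^sub>v n"
    and Av: "map_mat complex_of_real A *\<^sub>v v = c \<cdot>\<^sub>v v"
    by (auto simp: eigenvalue_def eigenvector_def)
  define x where "x = map_vec Re v"
  define y where "y = map_vec Im v"
  have xy: "x \<in> carrier_vec n" "y \<in> carrier_vec n"
    using v by (auto simp: x_def y_def)
  have Ax: "A *\<^sub>v x = Re c \<cdot>\<^sub>v x - Im c \<cdot>\<^sub>v y" and Ay: "A *\<^sub>v y = Im c \<cdot>\<^sub>v x + Re c \<cdot>\<^sub>v y"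
  proof -
    \<comment> \<open>As the entries of \<open>A\<close> are real, the real and imaginary parts of
      this coordinate equation are the two real equations.\<close>
    have *: "(\<Sum>j\<in>{0..<n}. complex_of_real (A $$ (i, j)) * v $ j) = c * v $ i" if "i < n" for i
      using arg_cong[OF Av, of "\<lambda>w. w $ i"] that A v
      by (auto simp: scalar_prod_def)
    show "A *\<^sub>v x = Re c \<cdot>\<^sub>v x - Im c \<cdot>\<^sub>v y"
      using A v arg_cong[OF *, of _ Re] by (intro eq_vecI) (auto simp: x_def y_def scalar_prod_def)
    show "A *\<^sub>v y = Im c \<cdot>\<^sub>v x + Re c \<cdot>\<^sub>v y"
      using A v arg_cong[OF *, of _ Im] by (intro eq_vecI) (auto simp: x_def y_def scalar_prod_def)
  qed
  have "(A *\<^sub>v x) \<bullet> y = x \<bullet> (A *\<^sub>v y)"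
    by (rule symmetric_mat_self_adjoint[OF A xy])
  then have "Im c * (x \<bullet> x + y \<bullet> y) = 0"
    using xy by (simp add: Ax Ay minus_scalar_prod_distrib[of _ n] scalar_prod_add_distrib[of _ n]
        algebra_simps comm_scalar_prod[of y n x])
  moreover have "x \<bullet> x + y \<bullet> y \<noteq> 0"
  proof
    assume "x \<bullet> x + y \<bullet> y = 0"
    then have "x \<bullet> x = 0" "y \<bullet> y = 0"
      using scalar_prod_self_nonneg[of x] scalar_prod_self_nonneg[of y] by linarith+
    then have xy0: "x = 0\<^sub>v n" "y = 0\<^sub>v n" using scalar_prod_self_eq_0_iff xy by auto
    have "v = 0\<^sub>v n"
    proof (rule eq_vecI)
      fix i assume "i < dim_vec (0\<^sub>v n :: complex vec)"
      then show "v $ i = 0\<^sub>v n $ i"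
        using arg_cong[OF xy0(1), of "\<lambda>w. w $ i"] arg_cong[OF xy0(2), of "\<lambda>w. w $ i"] v
        by (simp add: x_def y_def complex_eq_iff)
    qed (use v in auto)
    with v show False by simp
  qed
  ultimately show ?thesis by simp
qed

text \<open>Over the complex numbers the characteristic polynomial splits, so it has a root as
  \<open>n > 0\<close>. The root is real by symmetry, hence also a root of the real characteristic
  polynomial, and its real eigenvector can be normalised.\<close>

lemma symmetric_real_mat_has_unit_eigenvector:
  assumes A: "(A :: real mat) \<in> carrier_mat n n" "transpose_mat A = A" and n: "n > 0"
  obtains e u where "u \<in> carrier_vec n" "u \<bullet> u = 1" "A *\<^sub>v u = e \<cdot>\<^sub>v u"
proof -
  let ?C = "map_mat complex_of_real A"
  have C: "?C \<in> carrier_mat n n" using A by simp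
  obtain as where as: "char_poly ?C = (\<Prod>a\<leftarrow>as. [:- a, 1:])" "length as = n"
    using char_poly_factorized[OF C] by blast
  with n obtain c cs where "as = c # cs" by (cases as) auto
  then have "poly (char_poly ?C) c = 0" using as by simp
  then have ev: "eigenvalue ?C c" using eigenvalue_root_char_poly[OF C] by simp
  have c: "c = complex_of_real (Re c)"
    using symmetric_real_mat_eigenvalue_real[OF A ev] by (simp add: complex_eq_iff)
  interpret of_real_poly: map_poly_inj_idom_hom complex_of_real ..
  have "poly (char_poly A) (Re c) = 0"
    using \<open>poly (char_poly ?C) c = 0\<close>
    by (subst (asm) c, subst (asm) of_real_hom.char_poly_hom[OF A(1)]) simp
  then have "eigenvalue A (Re c)" using eigenvalue_root_char_poly[OF A(1)] by simp
  then obtain v where v: "v \<in> carrier_vec n" "v \<noteq> 0\<^sub>v n" "A *\<^sub>v v = Re c \<cdot>\<^sub>v v"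
    using A by (auto simp: eigenvalue_def eigenvector_def)
  have pos: "v \<bullet> v > 0" by (rule scalar_prod_self_pos[OF v(1,2)])
  let ?u = "(1 / sqrt (v \<bullet> v)) \<cdot>\<^sub>v v"
  show ?thesis
  proof (rule that)
    show "?u \<in> carrier_vec n" using v by simp
    show "?u \<bullet> ?u = 1" using v pos
      by (simp add: smult_scalar_prod_distrib[of _ n] scalar_prod_smult_distrib[of _ n] field_simps)
    show "A *\<^sub>v ?u = Re c \<cdot>\<^sub>v ?u"
      using v A by (simp add: mult_mat_vec[of _ n n] smult_smult_assoc mult.commute)
  qed
qed

text \<open>The Householder reflection exchanging the first unit vector and \<open>u\<close>.\<close>

lemma orthogonal_mat_with_first_column:
  assumes u: "(u :: real vec) \<in> carrier_vec n" "u \<bullet> u = 1" and n: "n > 0"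
  obtains H where "H \<in> carrier_mat n n" "transpose_mat H * H = 1\<^sub>m n" "col H 0 = u"
proof -
  define w where "w = u - unit_vec n 0"
  define s where "s = w \<bullet> w"
  \<comment> \<open>This is I - 2 w w^T / s. If \<open>u\<close> is already the first unit vector,
    then w and \<open>s\<close> are 0 and \<open>H\<close> is the identity.\<close>
  define H where "H = mat n n (\<lambda>(i, j). (if i = j then 1 else 0) - 2 / s * (w $ i * w $ j))"
  have w: "w \<in> carrier_vec n" and H: "H \<in> carrier_mat n n"
    using u by (auto simp: w_def H_def)
  have s_sum: "s = (\<Sum>k\<in>{0..<n}. w $ k * w $ k)"
    using w by (simp add: s_def scalar_prod_def)
  \<comment> \<open>This uses that \<open>u\<close> has norm 1. The value is -2 times
    \<open>w $ 0\<close>, so for nonzero \<open>s\<close> the first column of \<open>H\<close> is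
    the first unit vector plus \<open>w\<close>, which is \<open>u\<close>.\<close>
  have s_u: "s = 2 - 2 * u $ 0"
    using u n by (simp add: s_def w_def minus_scalar_prod_distrib[of _ n]
        scalar_prod_minus_distrib[of _ n])
  have w0: "w $ 0 = u $ 0 - 1" using u n by (simp add: w_def)
  have orth: "transpose_mat H * H = 1\<^sub>m n"
  proof (rule eq_matI)
    fix i j assume "i < dim_row (1\<^sub>m n :: real mat)" "j < dim_col (1\<^sub>m n :: real mat)"
    then have ij: "i < n" "j < n" by auto
    let ?c = "2 / s"
    have "(transpose_mat H * H) $$ (i, j) = (\<Sum>k\<in>{0..<n}. H $$ (k, i) * H $$ (k, j))"
      using ij H by (simp add: scalar_prod_def)
    also have "\<dots> = (\<Sum>k\<in>{0..<n}. (if k = i then (if i = j then 1 else 0) - ?c * (w $ i * w $ j) else 0)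
        - (if k = j then ?c * (w $ i * w $ j) else 0)
        + ?c\<^sup>2 * (w $ i * w $ j) * (w $ k * w $ k))"
      using ij by (intro sum.cong) (auto simp: H_def power2_eq_square algebra_simps)
    also have "\<dots> = (if i = j then 1 else 0) - ?c * (w $ i * w $ j) - ?c * (w $ i * w $ j)
        + ?c\<^sup>2 * (w $ i * w $ j) * s"
      using ij by (simp add: sum.distrib sum_subtractf sum_distrib_left[symmetric] s_sum)
    \<comment> \<open>The remaining terms cancel since -2c + c^2 s = 0 for c = 2 / s; for s = 0 also
      c = 0.\<close>
    also have "\<dots> = (if i = j then 1 else 0)"
      by (cases "s = 0") (auto simp: power2_eq_square field_simps)
    finally show "(transpose_mat H * H) $$ (i, j) = 1\<^sub>m n $$ (i, j)" using ij by simp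
  qed (use H in auto)
  have col: "col H 0 = u"
  proof (rule eq_vecI)
    fix i assume "i < dim_vec u"
    then have i: "i < n" using u by simp
    have "w $ i = 0" if "s = 0"
      using that w i scalar_prod_self_eq_0_iff[OF w] by (simp add: s_def)
    then have "2 / s * (w $ i * w $ 0) = - (w $ i)"
      by (cases "s = 0") (auto simp: w0 s_u field_simps)
    then show "col H 0 $ i = u $ i" using i n u by (auto simp: H_def w_def)
  qed (use H u in auto)
  show ?thesis using that H orth col by blast
qed

lemma mult_four_block_diag_mat:
  assumes "A \<in> carrier_mat k k" "B \<in> carrier_mat n n" "C \<in> carrier_mat k k" "D \<in> carrier_mat n n"
  shows "four_block_mat A (0\<^sub>m k n) (0\<^sub>m n k) B * four_block_mat C (0\<^sub>m k n) (0\<^sub>m n k) D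
    = four_block_mat (A * C) (0\<^sub>m k n) (0\<^sub>m n k) (B * (D :: 'a :: semiring_0 mat))"
  by (subst mult_four_block_mat[of _ k k _ n _ n _ _ k _ n])
    (use assms in \<open>auto intro!: cong_four_block_mat\<close>)

text \<open>Deflation, by induction on the dimension: an orthogonal change of basis makes a unit
  eigenvector the first basis vector. Symmetry then splits the matrix into its eigenvalue and a
  smaller symmetric block.\<close>

theorem symmetric_real_mat_spectral:
  assumes "(A :: real mat) \<in> carrier_mat n n" "transpose_mat A = A"
  shows "\<exists>P d. P \<in> carrier_mat n n \<and> transpose_mat P * P = 1\<^sub>m n \<and>
    A = P * mat_diag n d * transpose_mat P"
  using assms
proof (induction n arbitrary: A)
  case 0
  then show ?case by (intro exI[of _ "1\<^sub>m 0"]) (auto intro!: eq_matI)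
next
  case (Suc n A)
  note A = Suc.prems
  let ?N = "Suc n"
  obtain e u where u: "u \<in> carrier_vec ?N" "u \<bullet> u = 1" "A *\<^sub>v u = e \<cdot>\<^sub>v u"
    using symmetric_real_mat_has_unit_eigenvector[OF A] by blast
  obtain H where H: "H \<in> carrier_mat ?N ?N" "transpose_mat H * H = 1\<^sub>m ?N" "col H 0 = u"
    using orthogonal_mat_with_first_column[OF u(1,2)] by blast
  let ?Ht = "transpose_mat H"
  have Ht: "?Ht \<in> carrier_mat ?N ?N" using H by simp
  have HHt: "H * ?Ht = 1\<^sub>m ?N"
    by (rule mat_mult_left_right_inverse[OF Ht H(1,2)])
  define B where "B = ?Ht * A * H"
  have B: "B \<in> carrier_mat ?N ?N" using H A by (simp add: B_def)
  have AH: "?Ht * A \<in> carrier_mat ?N ?N" using H A by simp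
  have B_sym: "transpose_mat B = B"
    unfolding B_def transpose_mult[OF AH H(1)] transpose_mult[OF Ht A(1)] A(2) transpose_transpose
    by (rule assoc_mult_mat[OF Ht A(1) H(1), symmetric])
  \<comment> \<open>\<open>H\<close> takes the first unit vector to \<open>u\<close>,
    \<open>A\<close> scales it by \<open>e\<close>, and the transpose of \<open>H\<close> takes it
    back. So the first column of \<open>B\<close> is \<open>e\<close> times the first unit vector,
    and by symmetry so is the first row.\<close>
  have "col B 0 = (?Ht * A) *\<^sub>v col H 0"
    unfolding B_def by (rule col_mult2[OF AH H(1)]) simp
  also have "\<dots> = ?Ht *\<^sub>v (A *\<^sub>v col H 0)"
    by (rule assoc_mult_mat_vec[OF Ht A(1) u(1)[folded H(3)]])
  also have "\<dots> = e \<cdot>\<^sub>v (?Ht *\<^sub>v col H 0)"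
    using u H Ht by (simp add: mult_mat_vec[of _ ?N ?N])
  also have "?Ht *\<^sub>v col H 0 = col (1\<^sub>m ?N) 0"
    unfolding H(2)[symmetric] by (rule col_mult2[OF Ht H(1), symmetric]) simp
  finally have col_B: "col B 0 = e \<cdot>\<^sub>v unit_vec ?N 0" by simp
  have B_0: "B $$ (i, 0) = (if i = 0 then e else 0)" if "i < ?N" for i
    using arg_cong[OF col_B, of "\<lambda>w. w $ i"] that B by auto
  have B_0': "B $$ (0, i) = (if i = 0 then e else 0)" if "i < ?N" for i
    using B_0[OF that] arg_cong[OF B_sym, of "\<lambda>M. M $$ (i, 0)"] that B by auto
  define B' where "B' = mat n n (\<lambda>(i, j). B $$ (Suc i, Suc j))"
  have B': "B' \<in> carrier_mat n n" by (simp add: B'_def)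
  have "transpose_mat B' = B'"
  proof (rule eq_matI)
    fix i j assume "i < dim_row B'" "j < dim_col B'"
    then show "transpose_mat B' $$ (i, j) = B' $$ (i, j)"
      using arg_cong[OF B_sym, of "\<lambda>M. M $$ (Suc i, Suc j)"] B by (simp add: B'_def)
  qed (use B' in auto)
  from Suc.IH[OF B' this] obtain Q d where Q: "Q \<in> carrier_mat n n" "transpose_mat Q * Q = 1\<^sub>m n"
    and B'_eq: "B' = Q * mat_diag n d * transpose_mat Q" by blast
  \<comment> \<open>\<open>R\<close> fixes the first coordinate and acts as \<open>Q\<close> on the
    others; \<open>d'\<close> puts \<open>e\<close> in front of the eigenvalues of the smaller
    block.\<close>
  define R where "R = four_block_mat (1\<^sub>m 1) (0\<^sub>m 1 n) (0\<^sub>m n 1) Q"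
  define d' where "d' = (\<lambda>i. case i of 0 \<Rightarrow> e | Suc j \<Rightarrow> d j)"
  have R: "R \<in> carrier_mat ?N ?N"
    using four_block_carrier_mat[of "1\<^sub>m 1 :: real mat" 1 1 Q n n] Q by (simp add: R_def)
  have Rt_eq: "transpose_mat R = four_block_mat (1\<^sub>m 1) (0\<^sub>m 1 n) (0\<^sub>m n 1) (transpose_mat Q)"
    using Q by (simp add: R_def transpose_four_block_mat[of _ 1 1 _ n _ n])
  have Rt: "transpose_mat R \<in> carrier_mat ?N ?N" using R by simp
  have D_eq: "mat_diag ?N d' = four_block_mat (mat_diag 1 (\<lambda>_. e)) (0\<^sub>m 1 n) (0\<^sub>m n 1) (mat_diag n d)"
    by (rule eq_matI) (auto simp: d'_def mat_diag_def split: nat.split)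
  have Qt: "transpose_mat Q \<in> carrier_mat n n" using Q by simp
  note block_mult = mult_four_block_diag_mat[of _ 1 _ n]
  have one: "(1\<^sub>m 1 :: real mat) \<in> carrier_mat 1 1" by simp
  have R_orth: "transpose_mat R * R = 1\<^sub>m ?N"
    unfolding Rt_eq unfolding R_def block_mult[OF one Qt one Q(1)] Q(2)
    using four_block_one_mat[of 1 n] by simp
  have B_block: "B = four_block_mat (mat_diag 1 (\<lambda>_. e)) (0\<^sub>m 1 n) (0\<^sub>m n 1) B'"
    using B B_0 B_0' by (intro eq_matI) (auto simp: B'_def mat_diag_def)
  have D1: "mat_diag 1 (\<lambda>_. e) \<in> carrier_mat 1 1" by simp
  have Dn: "mat_diag n d \<in> carrier_mat n n" by simp
  have QD: "Q * mat_diag n d \<in> carrier_mat n n" using Q by simp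
  have RD: "R * mat_diag ?N d' = four_block_mat (mat_diag 1 (\<lambda>_. e)) (0\<^sub>m 1 n) (0\<^sub>m n 1) (Q * mat_diag n d)"
    unfolding R_def D_eq block_mult[OF one Q(1) D1 Dn] left_mult_one_mat[OF D1] ..
  have B_eq: "B = R * mat_diag ?N d' * transpose_mat R"
    unfolding RD Rt_eq B_block B'_eq block_mult[OF D1 QD one Qt] right_mult_one_mat[OF D1] ..
  define P where "P = H * R"
  have P: "P \<in> carrier_mat ?N ?N" using H R by (simp add: P_def)
  have Pt: "transpose_mat P = transpose_mat R * ?Ht"
    unfolding P_def by (rule transpose_mult[OF H(1) R])
  have "transpose_mat P * P = transpose_mat R * (?Ht * H) * R"
    unfolding Pt unfolding P_def using H(1) Ht R Rt
    by (simp add: assoc_mult_mat[of _ ?N ?N _ ?N _ ?N] mult_carrier_mat[of _ ?N ?N _ ?N])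
  then have P_orth: "transpose_mat P * P = 1\<^sub>m ?N" using H(2) R_orth Rt by simp
  have "P * mat_diag ?N d' * transpose_mat P = H * (R * mat_diag ?N d' * transpose_mat R) * ?Ht"
    unfolding Pt unfolding P_def using H(1) Ht R Rt
    by (simp add: assoc_mult_mat[of _ ?N ?N _ ?N _ ?N] mult_carrier_mat[of _ ?N ?N _ ?N])
  also have "\<dots> = (H * ?Ht) * A * (H * ?Ht)"
    unfolding B_eq[symmetric] B_def using H(1) Ht A(1)
    by (simp add: assoc_mult_mat[of _ ?N ?N _ ?N _ ?N] mult_carrier_mat[of _ ?N ?N _ ?N])
  also have "\<dots> = A" using HHt A by simp
  finally show ?case using P P_orth by metis
qed

section \<open>Courant-Fischer bound for the second smallest eigenvalue\<close>

lemma similar_mat_orthogonal: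
  assumes P: "P \<in> carrier_mat n n" "transpose_mat P * P = 1\<^sub>m n"
    and D: "D \<in> carrier_mat n n"
  shows "similar_mat (P * D * transpose_mat P) (D :: 'a :: field mat)"
proof -
  have "P * transpose_mat P = 1\<^sub>m n"
    using mat_mult_left_right_inverse[OF _ P] P by simp
  then have "similar_mat_wit (P * D * transpose_mat P) D P (transpose_mat P)"
    using P D by (intro similar_mat_witI[of _ _ n]) auto
  then show ?thesis unfolding similar_mat_def by blast
qed

text \<open>Links \<open>eigenvalues_desc\<close>, defined by polynomial roots, to the diagonal
  entries that the spectral theorem supplies, multiplicities included.\<close>

lemma proots_char_poly_mat_diag:
  "proots (char_poly (mat_diag n d :: real mat)) = mset (map d [0..<n])"
proof -
  have "upper_triangular (mat_diag n d)" by (auto simp: mat_diag_def upper_triangular_def)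
  moreover have "diag_mat (mat_diag n d) = map d [0..<n]"
    by (auto simp: diag_mat_def mat_diag_def)
  ultimately have eq: "char_poly (mat_diag n d) = (\<Prod>a\<leftarrow>map d [0..<n]. [:- a, 1:])"
    using char_poly_upper_triangular[of "mat_diag n d" n] by simp
  have "proots (\<Prod>a\<leftarrow>as. [:- a, 1:]) = mset as" for as :: "real list"
  proof (induction as)
    case (Cons a as)
    have "(\<Prod>a\<leftarrow>as. [:- a, 1:]) \<noteq> 0" by (auto simp: prod_list_zero_iff)
    then show ?case using Cons by (simp add: proots_mult del: mult_pCons_left)
  qed simp
  then show ?thesis unfolding eq .
qed

text \<open>Take for \<open>k\<close> the position that sorting moves to the front; every other
  entry lands at index 1 or later. This isolates the single eigendirection whose eigenvalue may be
  at most \<open>r\<close>.\<close>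

lemma sort_nth_1_gt_imp:
  fixes xs :: "'a :: linorder list"
  assumes len: "length xs \<ge> 2" and gt: "sort xs ! 1 > r"
  obtains k where "k < length xs" "\<And>i. i < length xs \<Longrightarrow> i \<noteq> k \<Longrightarrow> xs ! i > r"
proof -
  have "mset xs = mset (sort xs)" by simp
  from mset_eq_permutation[OF this] obtain p
    where p: "p permutes {..<length xs}" "permute_list p (sort xs) = xs" by auto
  then have nth: "xs ! i = sort xs ! p i" if "i < length xs" for i
    using permute_list_nth[of p "sort xs" i] that by simp
  from p(1) len obtain k where k: "k < length xs" "p k = 0"
    by (metis lessThan_iff permutes_in_image permutes_surj surjD zero_less_numeral order_less_le_trans)
  show ?thesis
  proof (rule that[OF k(1)])
    fix i assume i: "i < length xs" "i \<noteq> k"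
    then have "p i \<noteq> 0" using k p(1) by (metis permutes_inj injD)
    moreover have "p i < length xs" using i p(1) permutes_in_image by fastforce
    ultimately have "sort xs ! 1 \<le> sort xs ! p i"
      by (intro sorted_nth_mono) auto
    then show "xs ! i > r" using gt nth i by simp
  qed
qed

lemma quadratic_form_mat_diag:
  fixes z :: "'a :: comm_semiring_0 vec"
  assumes "z \<in> carrier_vec n"
  shows "z \<bullet> (mat_diag n d *\<^sub>v z) = (\<Sum>i<n. d i * (z $ i * z $ i))"
proof -
  have "(mat_diag n d *\<^sub>v z) $ i = d i * z $ i" if "i < n" for i
  proof -
    have "(mat_diag n d *\<^sub>v z) $ i = (\<Sum>j\<in>{0..<n}. (if i = j then d j else 0) * z $ j)"
      using assms that by (simp add: mat_diag_def scalar_prod_def)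
    also have "\<dots> = (\<Sum>j\<in>{0..<n}. if i = j then d j * z $ j else 0)"
      by (intro sum.cong) auto
    finally show ?thesis using that by simp
  qed
  then show ?thesis
    using assms by (auto simp: scalar_prod_def mat_diag_def atLeast0LessThan ac_simps intro!: sum.cong)
qed

text \<open>The Courant--Fischer bound for a test plane spanned by \<open>x\<close> and \<open>y\<close>.\<close>

lemma second_smallest_eigenvalue_le:
  fixes A :: "real mat"
  assumes A: "A \<in> carrier_mat n n" "transpose_mat A = A" and n: "n \<ge> 2"
    and x: "x \<in> carrier_vec n" and y: "y \<in> carrier_vec n"
    and indep: "\<And>a b. a \<cdot>\<^sub>v x + b \<cdot>\<^sub>v y = 0\<^sub>v n \<Longrightarrow> a = 0 \<and> b = 0"
    and le: "\<And>a b. (a \<cdot>\<^sub>v x + b \<cdot>\<^sub>v y) \<bullet> (A *\<^sub>v (a \<cdot>\<^sub>v x + b \<cdot>\<^sub>v y))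
      \<le> r * ((a \<cdot>\<^sub>v x + b \<cdot>\<^sub>v y) \<bullet> (a \<cdot>\<^sub>v x + b \<cdot>\<^sub>v y))"
  shows "eigenvalues_desc A ! (n - 2) \<le> r"
proof (rule ccontr)
  obtain P d where P: "P \<in> carrier_mat n n" "transpose_mat P * P = 1\<^sub>m n"
    and A_eq: "A = P * mat_diag n d * transpose_mat P"
    using symmetric_real_mat_spectral[OF A] by blast
  let ?Pt = "transpose_mat P"
  have Pt: "?Pt \<in> carrier_mat n n" using P by simp
  have PPt: "P * ?Pt = 1\<^sub>m n" by (rule mat_mult_left_right_inverse[OF Pt P])
  have "char_poly A = char_poly (mat_diag n d)"
    unfolding A_eq by (intro char_poly_similar similar_mat_orthogonal[OF P]) simp
  then have eigs: "eigenvalues_desc A = rev (sort (map d [0..<n]))"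
    by (simp add: eigenvalues_desc_def proots_char_poly_mat_diag del: mset_map mset_upt)
  assume "\<not> eigenvalues_desc A ! (n - 2) \<le> r"
  \<comment> \<open>Reversal turns index \<open>n - 2\<close> of the descending list into index 1 of
    the ascending one, counted from 0: the second smallest entry.\<close>
  moreover have "n - Suc (n - 2) = 1" using n by simp
  ultimately have "sort (map d [0..<n]) ! 1 > r"
    using n by (simp add: eigs rev_nth)
  then obtain k where k: "k < n" "\<And>i. i < n \<Longrightarrow> i \<noteq> k \<Longrightarrow> d i > r"
    using sort_nth_1_gt_imp[of "map d [0..<n]" r] n by auto
  define p where "p = (?Pt *\<^sub>v x) $ k"
  define q where "q = (?Pt *\<^sub>v y) $ k"
  \<comment> \<open>One linear equation in two unknowns has a nonzero solution, so the plane
    contains a nonzero vector without component along eigenvector \<open>k\<close>.\<close>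
  obtain a b where ab: "a \<noteq> 0 \<or> b \<noteq> 0" "a * p + b * q = 0"
  proof (cases "p = 0 \<and> q = 0")
    case True then show ?thesis using that[of 1 0] by simp
  next
    case False then show ?thesis using that[of q "- p"] by auto
  qed
  define w where "w = a \<cdot>\<^sub>v x + b \<cdot>\<^sub>v y"
  have w: "w \<in> carrier_vec n" using x y by (simp add: w_def)
  define z where "z = ?Pt *\<^sub>v w"
  have z: "z \<in> carrier_vec n" using Pt w by (simp add: z_def)
  have w_eq: "w = P *\<^sub>v z"
    using w P Pt by (simp add: z_def assoc_mult_mat_vec[symmetric, of _ n n _ n] PPt)
  have "z = a \<cdot>\<^sub>v (?Pt *\<^sub>v x) + b \<cdot>\<^sub>v (?Pt *\<^sub>v y)"
    using Pt x y by (simp add: z_def w_def mult_add_distrib_mat_vec[of _ n n] mult_mat_vec[of _ n n])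
  then have zk: "z $ k = 0" using ab k(1) Pt x y by (simp add: p_def q_def)
  have "z \<noteq> 0\<^sub>v n"
  proof
    assume "z = 0\<^sub>v n"
    then have "w = 0\<^sub>v n" using P(1) w_eq by (auto intro!: eq_vecI)
    then show False using indep ab(1) by (auto simp: w_def)
  qed
  then obtain m where m: "m < n" "z $ m \<noteq> 0" using z by (metis carrier_vecD eq_vecI index_zero_vec)
  with zk have mk: "m \<noteq> k" by auto
  have move: "w \<bullet> (P *\<^sub>v v) = z \<bullet> v" if "v \<in> carrier_vec n" for v
    using transpose_vec_mult_scalar[OF P(1) that w] by (simp add: z_def)
  have "w \<bullet> (A *\<^sub>v w) = w \<bullet> (P *\<^sub>v (mat_diag n d *\<^sub>v z))"
    using P Pt w by (simp add: A_eq z_def assoc_mult_mat_vec[of _ n n _ n])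
  also have "\<dots> = (\<Sum>i<n. d i * (z $ i * z $ i))"
    using z mult_mat_vec_carrier[OF mat_diag_dim z] by (simp add: move quadratic_form_mat_diag)
  \<comment> \<open>At \<open>k\<close> both terms are 0, and elsewhere \<open>d i > r\<close>. The
    nonzero coordinate \<open>m\<close>, distinct from \<open>k\<close>, makes the inequality
    strict.\<close>
  also have "\<dots> > (\<Sum>i<n. r * (z $ i * z $ i))"
  proof (rule sum_strict_mono_ex1)
    show "\<forall>i\<in>{..<n}. r * (z $ i * z $ i) \<le> d i * (z $ i * z $ i)"
    proof
      fix i assume "i \<in> {..<n}"
      then show "r * (z $ i * z $ i) \<le> d i * (z $ i * z $ i)"
        using k(2)[of i] zk by (cases "i = k") (auto intro!: mult_right_mono)
    qed
    show "\<exists>i\<in>{..<n}. r * (z $ i * z $ i) < d i * (z $ i * z $ i)"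
      using m mk k(2)[of m] by (intro bexI[of _ m] mult_strict_right_mono)
        (auto simp: zero_less_mult_iff linorder_neq_iff)
  qed simp
  also have "(\<Sum>i<n. r * (z $ i * z $ i)) = r * (z \<bullet> z)"
    using z by (simp add: scalar_prod_def sum_distrib_left atLeast0LessThan)
  also have "z \<bullet> z = w \<bullet> w" using move[OF z] w_eq by simp
  finally show False using le[of a b] by (simp add: w_def)
qed

section \<open>Test vectors for symmetric matrices with zero row sums\<close>

text \<open>The all-ones vector lies in the kernel of \<open>M\<close> and is orthogonal to
  \<open>x\<close>, so on their span the quadratic form sees only the component along
  \<open>x\<close>, while the squared norm can only gain from the other component.\<close>

lemma second_smallest_eigenvalue_le_zero_row_sums:
  fixes M :: "real mat"
  assumes M: "M \<in> carrier_mat n n" "transpose_mat M = M" and n: "n \<ge> 2"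
    and rows: "\<And>i. i < n \<Longrightarrow> (\<Sum>j<n. M $$ (i, j)) = 0"
    and x: "x \<in> carrier_vec n" "x \<noteq> 0\<^sub>v n" "(\<Sum>i<n. x $ i) = 0"
    and r: "r \<ge> 0" and le: "x \<bullet> (M *\<^sub>v x) \<le> r * (x \<bullet> x)"
  shows "eigenvalues_desc M ! (n - 2) \<le> r"
proof -
  define e :: "real vec" where "e = vec n (\<lambda>_. 1)"
  have e: "e \<in> carrier_vec n" by (simp add: e_def)
  have Me: "M *\<^sub>v e = 0\<^sub>v n"
    using M rows by (intro eq_vecI) (auto simp: e_def scalar_prod_def atLeast0LessThan)
  have ex: "e \<bullet> x = 0" "x \<bullet> e = 0"
    using x by (auto simp: e_def scalar_prod_def atLeast0LessThan)
  have ee: "e \<bullet> e = real n" by (simp add: e_def scalar_prod_def)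
  have Mx: "M *\<^sub>v x \<in> carrier_vec n" using M x by simp
  have eMx: "e \<bullet> (M *\<^sub>v x) = 0"
    using symmetric_mat_self_adjoint[OF M e x(1)] x by (simp add: Me)
  have xx: "x \<bullet> x > 0" by (rule scalar_prod_self_pos[OF x(1,2)])
  show ?thesis
  proof (rule second_smallest_eigenvalue_le[OF M n e x(1)])
    fix a b
    let ?w = "a \<cdot>\<^sub>v e + b \<cdot>\<^sub>v x"
    \<comment> \<open>These two products give both the linear independence and the squared norm of
      the combination.\<close>
    have we: "?w \<bullet> e = a * real n" and wx: "?w \<bullet> x = b * (x \<bullet> x)"
      using e x ex ee by (simp_all add: add_scalar_prod_distrib[of _ n] smult_scalar_prod_distrib[of _ n])
    {
      assume "?w = 0\<^sub>v n"
      then show "a = 0 \<and> b = 0" using we wx e x xx n by auto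
    }
    have "a \<cdot>\<^sub>v 0\<^sub>v n = (0\<^sub>v n :: real vec)" by auto
    then have "M *\<^sub>v ?w = b \<cdot>\<^sub>v (M *\<^sub>v x)"
      using M e x Me Mx by (simp add: mult_add_distrib_mat_vec[of _ n n] mult_mat_vec[of _ n n])
    then have "?w \<bullet> (M *\<^sub>v ?w) = b\<^sup>2 * (x \<bullet> (M *\<^sub>v x))"
      using e x Mx eMx by (simp add: add_scalar_prod_distrib[of _ n] smult_scalar_prod_distrib[of _ n]
          scalar_prod_smult_distrib[of _ n] power2_eq_square)
    also have "\<dots> \<le> b\<^sup>2 * (r * (x \<bullet> x))" using le by (intro mult_left_mono) auto
    \<comment> \<open>Adding the norm contribution of the all-ones vector preserves the bound
      because \<open>r\<close> is nonnegative.\<close>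
    also have "\<dots> \<le> r * (a\<^sup>2 * real n + b\<^sup>2 * (x \<bullet> x))"
      using r by (simp add: algebra_simps)
    also have "a\<^sup>2 * real n + b\<^sup>2 * (x \<bullet> x) = ?w \<bullet> ?w"
      using e x we wx by (simp add: scalar_prod_add_distrib[of _ n] scalar_prod_smult_distrib[of _ n]
          power2_eq_square)
    finally show "?w \<bullet> (M *\<^sub>v ?w) \<le> r * (?w \<bullet> ?w)" .
  qed
qed

text \<open>The test vector is the difference of the unit vectors at \<open>p\<close> and
  \<open>q\<close>: its coordinates sum to 0, its squared norm is 2, and the cross terms of the form
  are the vanishing entries at (p, q) and (q, p).\<close>

lemma second_smallest_eigenvalue_le_avg_diag:
  fixes M :: "real mat"
  assumes M: "M \<in> carrier_mat n n" "transpose_mat M = M"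
    and rows: "\<And>i. i < n \<Longrightarrow> (\<Sum>j<n. M $$ (i, j)) = 0"
    and diag: "M $$ (p, p) \<ge> 0" "M $$ (q, q) \<ge> 0"
    and pq: "p < n" "q < n" "p \<noteq> q" "M $$ (p, q) = 0"
  shows "eigenvalues_desc M ! (n - 2) \<le> (M $$ (p, p) + M $$ (q, q)) / 2"
proof -
  have "M $$ (q, p) = 0"
    using arg_cong[OF M(2), of "\<lambda>N. N $$ (q, p)"] M(1) pq by simp
  let ?p = "unit_vec n p :: real vec" and ?q = "unit_vec n q :: real vec"
  let ?x = "?p - ?q"
  have x: "?x \<in> carrier_vec n" by simp
  have "M *\<^sub>v unit_vec n i = col M i" if "i < n" for i
    using M(1) that by (intro eq_vecI) auto
  then have "M *\<^sub>v ?x = col M p - col M q"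
    using M(1) pq by (simp add: mult_minus_distrib_mat_vec[of _ n n])
  then have form: "?x \<bullet> (M *\<^sub>v ?x) = M $$ (p, p) + M $$ (q, q)"
    using M(1) pq \<open>M $$ (q, p) = 0\<close> by (simp add: minus_scalar_prod_distrib[of _ n])
  have xx: "?x \<bullet> ?x = 2"
    using pq by (simp add: minus_scalar_prod_distrib[of _ n])
  show ?thesis
  proof (rule second_smallest_eigenvalue_le_zero_row_sums[OF M _ rows x])
    show "?x \<noteq> 0\<^sub>v n" using xx by auto
    show "(\<Sum>i<n. ?x $ i) = 0"
      using pq by (simp add: sum_subtractf unit_vec_def)
  qed (use pq diag form xx in auto)
qed

text \<open>The test vector comes from Fiedler's bound of the algebraic connectivity of a non-complete
  graph by its minimum degree: with \<open>T\<close> the set of non-neighbours of \<open>p\<close>, it takes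
  the value \<open>card T\<close> at \<open>p\<close>, \<open>-1\<close> on \<open>T\<close> and \<open>0\<close> on the neighbours of \<open>p\<close>.\<close>

lemma second_smallest_eigenvalue_le_diag:
  fixes M :: "real mat"
  assumes M: "M \<in> carrier_mat n n" "transpose_mat M = M"
    and rows: "\<And>i. i < n \<Longrightarrow> (\<Sum>j<n. M $$ (i, j)) = 0"
    and offdiag: "\<And>i j. i < n \<Longrightarrow> j < n \<Longrightarrow> i \<noteq> j \<Longrightarrow> M $$ (i, j) \<in> {0, -1}"
    and pq: "p < n" "q < n" "p \<noteq> q" "M $$ (p, q) = 0"
  shows "eigenvalues_desc M ! (n - 2) \<le> M $$ (p, p)"
proof -
  define T where "T = {i. i < n \<and> i \<noteq> p \<and> M $$ (p, i) = 0}"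
  define N where "N = {i. i < n \<and> i \<noteq> p \<and> M $$ (p, i) = -1}"
  define t where "t = real (card T)"
  define x where "x = vec n (\<lambda>i. if i = p then t else if i \<in> T then -1 else 0)"
  have fin: "finite T" "finite N" by (auto simp: T_def N_def)
  \<comment> \<open>Every off-diagonal entry is 0 or -1, so each index other than \<open>p\<close>
    is a non-neighbour or a neighbour of \<open>p\<close>.\<close>
  have split: "{..<n} = insert p (T \<union> N)"
    using offdiag pq by (auto simp: T_def N_def)
  have disj: "p \<notin> T" "p \<notin> N" "T \<inter> N = {}" by (auto simp: T_def N_def)
  have sum_split: "(\<Sum>i<n. f i) = f p + (\<Sum>i\<in>T. f i) + (\<Sum>i\<in>N. f i)" for f :: "nat \<Rightarrow> real"
    using disj fin unfolding split by (simp add: sum.union_disjoint)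
  have in_n: "i < n" if "i \<in> T \<union> N" for i using that by (auto simp: T_def N_def)
  have x: "x \<in> carrier_vec n" by (simp add: x_def)
  have x_p: "x $ p = t" and x_T: "\<And>i. i \<in> T \<Longrightarrow> x $ i = -1" and x_N: "\<And>i. i \<in> N \<Longrightarrow> x $ i = 0"
    using pq disj by (auto simp: x_def T_def N_def)
  have t: "t > 0"
  proof -
    have "q \<in> T" using pq by (auto simp: T_def)
    then have "card T > 0" using fin by (auto simp: card_gt_0_iff)
    then show ?thesis by (simp add: t_def)
  qed
  have xsum: "(\<Sum>i<n. x $ i) = 0" and xx: "x \<bullet> x = t\<^sup>2 + t"
    using x by (simp_all add: sum_split x_p x_T x_N t_def scalar_prod_def atLeast0LessThan power2_eq_square)
  have deg: "M $$ (p, p) = real (card N)"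
    using rows[OF pq(1)] unfolding sum_split by (simp add: T_def N_def)
  have Mx: "(M *\<^sub>v x) $ i = t * M $$ (i, p) - (\<Sum>j\<in>T. M $$ (i, j))" if "i < n" for i
    using M x that
    by (simp add: scalar_prod_def atLeast0LessThan sum_split x_p x_T x_N sum_negf mult.commute)
  have Mx_p: "(M *\<^sub>v x) $ p = t * M $$ (p, p)"
    using Mx[OF pq(1)] by (simp add: T_def)
  \<comment> \<open>For \<open>i\<close> in \<open>T\<close> the entry at (i, p) is 0, so the zero
    row sum trades the sum over \<open>T\<close> for one over \<open>N\<close>. Each entry there is
    at least -1, and \<open>N\<close> has \<open>M $$ (p, p)\<close> elements.\<close>
  have Mx_T: "(M *\<^sub>v x) $ i \<ge> - M $$ (p, p)" if "i \<in> T" for i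
  proof -
    have i: "i < n" "i \<noteq> p" using that by (auto simp: T_def)
    have ip: "M $$ (i, p) = 0"
      using arg_cong[OF M(2), of "\<lambda>N. N $$ (i, p)"] M(1) pq i that by (simp add: T_def)
    have "(M *\<^sub>v x) $ i = (\<Sum>j\<in>N. M $$ (i, j))"
      using Mx[OF i(1)] rows[OF i(1)] ip unfolding sum_split by simp
    also have "\<dots> \<ge> (\<Sum>j\<in>N. -1)"
    proof (rule sum_mono)
      fix j assume "j \<in> N"
      then show "-1 \<le> M $$ (i, j)"
        using offdiag[of i j] i in_n that disj by fastforce
    qed
    finally show ?thesis by (simp add: deg)
  qed
  have "x \<bullet> (M *\<^sub>v x) = t * (t * M $$ (p, p)) + (\<Sum>i\<in>T. - (M *\<^sub>v x) $ i)"
    using M x by (simp add: scalar_prod_def[of x] atLeast0LessThan sum_split x_p x_T x_N Mx_p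
        del: index_mult_mat_vec)
  \<comment> \<open>The index \<open>p\<close> contributes t^2 times the diagonal entry, and each of
    the t members of \<open>T\<close> at most that entry once; the squared norm of \<open>x\<close>
    is t^2 + t.\<close>
  also have "\<dots> \<le> t * (t * M $$ (p, p)) + (\<Sum>i\<in>T. M $$ (p, p))"
    using Mx_T by (intro add_left_mono sum_mono) (simp add: minus_le_iff)
  also have "\<dots> = M $$ (p, p) * (x \<bullet> x)"
    by (simp add: xx t_def[symmetric] power2_eq_square algebra_simps)
  finally have form: "x \<bullet> (M *\<^sub>v x) \<le> M $$ (p, p) * (x \<bullet> x)" .
  show ?thesis
  proof (rule second_smallest_eigenvalue_le_zero_row_sums[OF M _ rows x _ xsum _ form])
    show "x \<noteq> 0\<^sub>v n" using x_p pq t by auto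
  qed (use pq deg in auto)
qed

section \<open>Counting edges and arcs at a vertex\<close>

lemma sum_count_Upair:
  assumes "finite V" and "\<forall>e \<in># E. set_uprod e \<subseteq> V" and "\<forall>y. Upair y y \<notin># E" and "x \<in> V"
  shows "(\<Sum>y\<in>V. count E (Upair x y)) = size {#e \<in># E. x \<in> set_uprod e#}"
  using assms(2,3)
proof (induction E)
  case (add e E)
  obtain a b where e: "e = Upair a b" by (cases e)
  have "(\<Sum>y\<in>V. if Upair a b = Upair x y then 1 else 0 :: nat) = (if x \<in> {a, b} then 1 else 0)"
  proof -
    have ab: "a \<noteq> b" "a \<in> V" "b \<in> V" using add.prems e by auto
    \<comment> \<open>The unordered pair can match in two orders; since \<open>a\<close> and
      \<open>b\<close> differ, at most one of the summands is nonzero for each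
      \<open>y\<close>.\<close>
    have "(\<Sum>y\<in>V. if Upair a b = Upair x y then 1 else 0 :: nat)
        = (\<Sum>y\<in>V. (if y = b then if x = a then 1 else 0 else 0) + (if y = a then if x = b then 1 else 0 else 0))"
      using ab by (intro sum.cong) auto
    also have "\<dots> = (if x \<in> {a, b} then 1 else 0)"
      using ab \<open>finite V\<close> by (auto simp: sum.distrib)
    finally show ?thesis .
  qed
  moreover have "(\<Sum>y\<in>V. count (add_mset e E) (Upair x y))
      = (\<Sum>y\<in>V. count E (Upair x y) + (if Upair a b = Upair x y then 1 else 0))"
    by (intro sum.cong) (auto simp: e)
  ultimately show ?case using add by (simp add: sum.distrib e)
qed simp

lemma sum_count_Pair:
  assumes "finite V"
  shows "(\<forall>a \<in># E. snd a \<in> V) \<Longrightarrow> (\<Sum>y\<in>V. count E (x, y)) = size {#a \<in># E. fst a = x#}"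
    and "(\<forall>a \<in># E. fst a \<in> V) \<Longrightarrow> (\<Sum>y\<in>V. count E (y, x)) = size {#a \<in># E. snd a = x#}"
proof (induction E)
  case (add e E)
  obtain a b where e: "e = (a, b)" by (cases e)
  {
    case 1
    have "(\<Sum>y\<in>V. count (add_mset e E) (x, y))
        = (\<Sum>y\<in>V. count E (x, y) + (if y = b then if a = x then 1 else 0 else 0))"
      by (intro sum.cong) (auto simp: e)
    then show ?case using 1 add assms by (auto simp: sum.distrib e)
  next
    case 2
    have "(\<Sum>y\<in>V. count (add_mset e E) (y, x))
        = (\<Sum>y\<in>V. count E (y, x) + (if y = a then if b = x then 1 else 0 else 0))"
      by (intro sum.cong) (auto simp: e)
    then show ?case using 2 add assms by (auto simp: sum.distrib e)
  }
qed simp_all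

section \<open>The integrated Laplacian of a simple mixed graph\<close>

context
  fixes G :: "'a mixed_graph" and vs :: "'a list" and n :: nat
  assumes G: "simple_mixed_graph G" and vs: "distinct vs" "set vs = verts G"
    and n: "n = length vs"
begin

lemma integrated_laplacian_carrier: "integrated_laplacian G vs \<in> carrier_mat (2 * n) (2 * n)"
  by (intro carrier_matI)
    (simp_all add: integrated_laplacian_def integrated_adjacency_def edge_mat_def n)

lemma integrated_laplacian_index:
  assumes "i < n" "j < n"
  shows "integrated_laplacian G vs $$ (i, j) =
      (if i = j then real (deg G (vs ! i) + out_deg G (vs ! i)) else 0)
        - real (count (edges G) (Upair (vs ! i) (vs ! j)))"
    and "integrated_laplacian G vs $$ (i, n + j) = - real (count (arcs G) (vs ! i, vs ! j))"
    and "integrated_laplacian G vs $$ (n + i, j) = - real (count (arcs G) (vs ! j, vs ! i))"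
    and "integrated_laplacian G vs $$ (n + i, n + j) =
      (if i = j then real (deg G (vs ! i) + in_deg G (vs ! i)) else 0)
        - real (count (edges G) (Upair (vs ! i) (vs ! j)))"
  using assms
  by (auto simp: integrated_laplacian_def integrated_degree_def integrated_adjacency_def Let_def
      edge_mat_def arc_mat_def mat_diag_def n)

lemma index_split:
  assumes "k < 2 * n"
  obtains i where "i < n" "k = i" | i where "i < n" "k = n + i"
proof (cases "k < n")
  case False
  then have "k - n < n" "k = n + (k - n)" using assms by auto
  then show ?thesis using that(2) by blast
qed (use that(1) in auto)

lemma integrated_laplacian_symmetric:
  "transpose_mat (integrated_laplacian G vs) = integrated_laplacian G vs"
proof (rule eq_matI)
  fix i j
  assume "i < dim_row (integrated_laplacian G vs)" "j < dim_col (integrated_laplacian G vs)"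
  then have ij: "i < 2 * n" "j < 2 * n" using integrated_laplacian_carrier by auto
  from ij show "transpose_mat (integrated_laplacian G vs) $$ (i, j) = integrated_laplacian G vs $$ (i, j)"
    using integrated_laplacian_carrier
    by (elim index_split)
      (auto simp: integrated_laplacian_index intro!: arg_cong[where f = "count (edges G)"])
qed (use integrated_laplacian_carrier in auto)

text \<open>In a primed row the edge block sums to the degree and the arc block to the out-degree,
  which cancels the diagonal term; in a double-primed row the in-degree takes the place of the
  out-degree.\<close>

lemma integrated_laplacian_row_sum:
  assumes "k < 2 * n"
  shows "(\<Sum>j<2 * n. integrated_laplacian G vs $$ (k, j)) = 0"
proof -
  \<comment> \<open>Separates the columns of the primed copies from those of the double-primed
    copies.\<close>
  have split: "(\<Sum>j<m + l. f j) = (\<Sum>j<m. f j) + (\<Sum>j<l. f (m + j))" for f :: "nat \<Rightarrow> real" and m l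
    by (induction l) (simp_all add: add.assoc)
  \<comment> \<open>As \<open>vs\<close> lists each vertex once, sums over positions become sums
    over vertices.\<close>
  have reindex: "(\<Sum>j<n. g (vs ! j)) = (\<Sum>y\<in>verts G. g y)" for g :: "'a \<Rightarrow> nat"
    using sum.reindex_bij_betw[OF bij_betw_nth[OF vs(1) refl vs(2)[symmetric]], of g] by (simp add: n)
  have wf: "finite (verts G)" "\<forall>e \<in># edges G. set_uprod e \<subseteq> verts G" "\<forall>y. Upair y y \<notin># edges G"
    "\<forall>a \<in># arcs G. fst a \<in> verts G" "\<forall>a \<in># arcs G. snd a \<in> verts G"
    using G by (auto simp: simple_mixed_graph_def is_mixed_graph_def)
  have deg: "(\<Sum>j<n. count (edges G) (Upair (vs ! i) (vs ! j))) = deg G (vs ! i)"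
    and out: "(\<Sum>j<n. count (arcs G) (vs ! i, vs ! j)) = out_deg G (vs ! i)"
    and "in": "(\<Sum>j<n. count (arcs G) (vs ! j, vs ! i)) = in_deg G (vs ! i)" if "i < n" for i
  proof -
    have "vs ! i \<in> verts G" using that unfolding n vs(2)[symmetric] by (rule nth_mem)
    then show "(\<Sum>j<n. count (edges G) (Upair (vs ! i) (vs ! j))) = deg G (vs ! i)"
      unfolding deg_def reindex[of "\<lambda>y. count (edges G) (Upair (vs ! i) y)"]
      by (rule sum_count_Upair[OF wf(1-3)])
    show "(\<Sum>j<n. count (arcs G) (vs ! i, vs ! j)) = out_deg G (vs ! i)"
      unfolding out_deg_def reindex[of "\<lambda>y. count (arcs G) (vs ! i, y)"]
      by (rule sum_count_Pair(1)[OF wf(1,5)])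
    show "(\<Sum>j<n. count (arcs G) (vs ! j, vs ! i)) = in_deg G (vs ! i)"
      unfolding in_deg_def reindex[of "\<lambda>y. count (arcs G) (y, vs ! i)"]
      by (rule sum_count_Pair(2)[OF wf(1,4)])
  qed
  from assms show ?thesis
  proof (cases rule: index_split)
    case (1 i)
    then show ?thesis using deg[of i] out[of i]
      by (simp add: mult_2 split integrated_laplacian_index sum_subtractf sum_negf
          flip: of_nat_sum)
  next
    case (2 i)
    then show ?thesis using deg[of i] "in"[of i]
      by (simp add: mult_2 split integrated_laplacian_index sum_subtractf sum_negf
          flip: of_nat_sum)
  qed
qed

text \<open>Simplicity bounds all multiplicities by 1; this is what the Fiedler bound asks of the
  matrix.\<close>

lemma integrated_laplacian_offdiag:
  assumes "k < 2 * n" "l < 2 * n" "k \<noteq> l"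
  shows "integrated_laplacian G vs $$ (k, l) \<in> {0, -1}"
proof -
  have "count (edges G) e \<le> 1" "count (arcs G) a \<le> 1" for e a
    using G unfolding simple_mixed_graph_def by blast+
  then have "count (edges G) e = 0 \<or> count (edges G) e = 1"
    "count (arcs G) a = 0 \<or> count (arcs G) a = 1" for e a
    by (metis le_eq_less_or_eq less_one)+
  then show ?thesis using assms
    by (elim index_split) (auto simp: integrated_laplacian_index)
qed

lemma integrated_laplacian_diag:
  assumes "i < n"
  shows "integrated_laplacian G vs $$ (i, i) = real (deg G (vs ! i) + out_deg G (vs ! i))"
    and "integrated_laplacian G vs $$ (n + i, n + i) = real (deg G (vs ! i) + in_deg G (vs ! i))"
proof -
  have "Upair x x \<notin># edges G" for x using G by (simp add: simple_mixed_graph_def)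
  then have no_loop: "count (edges G) (Upair x x) = 0" for x by (rule not_in_iff[THEN iffD1])
  show "integrated_laplacian G vs $$ (i, i) = real (deg G (vs ! i) + out_deg G (vs ! i))"
    "integrated_laplacian G vs $$ (n + i, n + i) = real (deg G (vs ! i) + in_deg G (vs ! i))"
    using assms by (simp_all add: integrated_laplacian_index no_loop)
qed

text \<open>The first member bounds by the average of two diagonal entries, the second is the
  Fiedler bound by one diagonal entry.\<close>

lemmas integrated_laplacian_bounds =
  second_smallest_eigenvalue_le_avg_diag[OF integrated_laplacian_carrier
    integrated_laplacian_symmetric integrated_laplacian_row_sum]
  second_smallest_eigenvalue_le_diag[OF integrated_laplacian_carrier
    integrated_laplacian_symmetric integrated_laplacian_row_sum integrated_laplacian_offdiag]

end

section \<open>Choosing the vertex copies for each bound\<close>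

theorem theorem3p13:
  fixes G :: "'a mixed_graph" and vs :: "'a list" and n :: nat and u v :: 'a
  assumes "simple_mixed_graph G"
    and "distinct vs" and "set vs = verts G"
    and "n = card (verts G)"
    and "u \<in> verts G" and "v \<in> verts G"
  shows "(Upair u v \<notin># edges G \<longrightarrow>
            nu G vs (2 * n - 1)
              \<le> 1 / 2 * real (deg G u + deg G v + out_deg G u + out_deg G v) \<and>
            nu G vs (2 * n - 1)
              \<le> 1 / 2 * real (deg G u + deg G v + in_deg G u + in_deg G v)) \<and>
         ((u, v) \<notin># arcs G \<longrightarrow>
            nu G vs (2 * n - 1)
              \<le> 1 / 2 * real (deg G u + deg G v + out_deg G u + in_deg G v))"
proof -
  have n: "n = length vs" using assms(2-4) distinct_card[of vs] by simp
  note assumps = assms(1-3) n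
  note index = integrated_laplacian_index[OF assumps]
  note diag = integrated_laplacian_diag[OF assumps]
  note bounds = integrated_laplacian_bounds[OF assumps]
  obtain i j where ij: "i < n" "vs ! i = u" "j < n" "vs ! j = v"
    using assms(3,5,6) n by (metis in_set_conv_nth)
  have eq_iff: "i = j \<longleftrightarrow> u = v"
    using ij assms(2) n nth_eq_iff_index_eq by blast
  \<comment> \<open>Subscripts start at 1 and list positions at 0, so the second smallest of
    \<open>2 * n\<close> eigenvalues sits at position \<open>2 * n - 2\<close>.\<close>
  have nu_eq: "nu G vs (2 * n - 1) = eigenvalues_desc (integrated_laplacian G vs) ! (2 * n - 2)"
    by (simp add: nu_def numeral_2_eq_2)
  have "(x, x) \<notin># arcs G" for x using assms(1) by (simp add: simple_mixed_graph_def)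
  then have no_loop: "count (arcs G) (x, x) = 0" for x by (rule not_in_iff[THEN iffD1])
  show ?thesis
  proof (intro conjI impI)
    assume "Upair u v \<notin># edges G"
    then have uv: "count (edges G) (Upair u v) = 0" by (rule not_in_iff[THEN iffD1])
    show "nu G vs (2 * n - 1) \<le> 1 / 2 * real (deg G u + deg G v + out_deg G u + out_deg G v)"
    proof (cases "u = v")
      \<comment> \<open>Without a directed loop the entry at (u', u'') is 0, and the right-hand side
        is exactly the diagonal entry of u'.\<close>
      case True
      then show ?thesis using bounds(2)[of i "n + i"] ij
        unfolding nu_eq by (simp add: index(2) diag no_loop)
    next
      case False
      then have "i \<noteq> j" "integrated_laplacian G vs $$ (i, j) = 0"
        using ij eq_iff index(1)[of i j] uv by auto
      then show ?thesis using bounds(1)[of i j] ij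
        unfolding nu_eq by (simp add: diag)
    qed
    show "nu G vs (2 * n - 1) \<le> 1 / 2 * real (deg G u + deg G v + in_deg G u + in_deg G v)"
    proof (cases "u = v")
      \<comment> \<open>The same pair with the roles exchanged: now the diagonal entry of u'' is the
        bound.\<close>
      case True
      then show ?thesis using bounds(2)[of "n + i" i] ij
        unfolding nu_eq by (simp add: index(3) diag no_loop)
    next
      case False
      then have "i \<noteq> j" "integrated_laplacian G vs $$ (n + i, n + j) = 0"
        using ij eq_iff index(4)[of i j] uv by auto
      then show ?thesis using bounds(1)[of "n + i" "n + j"] ij
        unfolding nu_eq by (simp add: diag)
    qed
  next
    assume "(u, v) \<notin># arcs G"
    then have uv: "count (arcs G) (u, v) = 0" by (rule not_in_iff[THEN iffD1])
    \<comment> \<open>The copies u' and v'' have distinct indices even if \<open>u = v\<close>, so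
      the averaging bound covers both cases.\<close>
    show "nu G vs (2 * n - 1) \<le> 1 / 2 * real (deg G u + deg G v + out_deg G u + in_deg G v)"
      using bounds(1)[of i "n + j"] ij unfolding nu_eq by (simp add: index(2) diag uv)
  qed
qed

end
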